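(* The line graph $\Lambda(C_m^{(r_1)}\times C_n^{(r_2)})$ of a signed toroidal grid $C_m^{(r_1)}\times C_n^{(r_2)}$, where $0\le r_1\le m$ and $0\le r_2\le n$, has eigenvalues $$\lambda_{ij}=2\Big(\cos\frac{(2i-[r_1])\pi}{m}+\cos\frac{(2j-[r_2])\pi}{n}-1\Big),$$ all of which are $<2$ except that $\lambda_{mn}=2$ if $r_1$ and $r_2$ are even, as well as $2$ with additional multiplicity $mn$. The Laplacian eigenvalues are $$\lambda_{ij}^L=8-2\Big(\cos\frac{(2i-[r_1])\pi}{m}+\cos\frac{(2j-[r_2])\pi}{n}\Big),$$ all of which are $>4$ except that $\lambda_{mn}^L=4$ if $r_1$ and $r_2$ are even, as well as $4$ with additional multiplicity $mn$. The energy and the Laplacian energy are both equal to $$4mn+2\sum_{i=1}^m\sum_{j=1}^n\Big|\cos\frac{(2i-[r_1])\pi}{m}+\cos\frac{(2j-[r_2])\pi}{n}-1\Big|.$$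
   Context: The indices $i,j$ range over $1\le i\le m$, $1\le j\le n$. For an integer $r$, $[r]=0$ if $r$ is even and $[r]=1$ if $r$ is odd. A signed graph $\Sigma=(G,\sigma)$ is a finite simple graph $G=(V,E)$ with a function $\sigma:E\to\{+1,-1\}$. The sign of a cycle is the product of its edge signs. The adjacency matrix $A(\Sigma)$ has $(u,v)$ entry $\sigma(uv)$ if $u,v$ are adjacent and $0$ otherwise; its eigenvalues are the eigenvalues of $\Sigma$, and the energy is the sum of their absolute values. The Laplacian matrix is $L(\Sigma)=D(\Sigma)-A(\Sigma)$, $D(\Sigma)$ being the diagonal matrix of vertex degrees; its eigenvalues are the Laplacian eigenvalues. The Laplacian energy is $\sum_j|\lambda_j(L(\Sigma))-\bar d(\Sigma)|$, where $\lambda_j(L(\Sigma))$ are the eigenvalues of $L(\Sigma)$ and $\bar d(\Sigma)=2|E|/|V|$. The Cartesian product of signed graphs $\Sigma_i=(V_i,E_i,\sigma_i)$, $i=1,2$, is the signed graph on $V_1\times V_2$ in which $(u,v)(u',v')$ is an edge iff $v=v'$ and $uu'\in E_1$ (sign $\sigma_1(uu')$), or $u=u'$ and $vv'\in E_2$ (sign $\sigma_2(vv')$). $C_m^{(r)}$ denotes a signed cycle with $m$ vertices having exactly $r$ negative edges. Incidence matrix of a signed graph $\Sigma$ with $p$ vertices and $q$ edges: a $p\times q$ matrix $H(\Sigma)=[\eta_{ik}]$ with $\eta_{ik}=0$ if vertex $v_i$ is not incident with edge $e_k$, $\eta_{ik}=\pm1$ if it is, and $\eta_{ik}\eta_{jk}=-\sigma(v_iv_j)$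 for each edge $e_k=v_iv_j$; unique up to multiplying columns by $-1$. Line graph: $\Lambda(\Sigma)$ is the signed graph whose underlying graph is the ordinary line graph of $G$, with signature given by $A(\Lambda(\Sigma))=2I_q-H(\Sigma)^{\mathrm T}H(\Sigma)$ (so every cycle of $\Sigma$ becomes a cycle of the same sign, and any three edges at a common vertex become a negative triangle); the choice of $H(\Sigma)$ does not affect eigenvalues or Laplacian eigenvalues.
   Formalization: The common value of the energy and Laplacian energy is proved with first term 2mn instead of the printed 4mn, which is false: the eigenvalue 2 of additional multiplicity mn contributes 2mn (for m=n=3, r_1=r_2=0 the energy is 40, not 58). *)

theory Defs
  imports Complex_Main "Jordan_Normal_Form.Char_Poly"
begin

record 'v sgraph =
  verts :: "'v set"
  edges :: "'v set set"
  sig :: "'v set \<Rightarrow> int"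

definition signed_graph :: "'v sgraph \<Rightarrow> bool" where
  "signed_graph S \<longleftrightarrow>
     finite (verts S) \<and>
     (\<forall>e\<in>edges S. e \<subseteq> verts S \<and> card e = 2) \<and>
     (\<forall>e\<in>edges S. sig S e \<in> {1, -1})"

definition vertex_degree :: "'v sgraph \<Rightarrow> 'v \<Rightarrow> nat" where
  "vertex_degree S v = card {e \<in> edges S. v \<in> e}"

definition adj :: "'v sgraph \<Rightarrow> 'v \<Rightarrow> 'v \<Rightarrow> real" where
  "adj S u v = (if {u, v} \<in> edges S then real_of_int (sig S {u, v}) else 0)"

definition laplacian :: "'v sgraph \<Rightarrow> 'v \<Rightarrow> 'v \<Rightarrow> real" where
  "laplacian S u v = (if u = v then real (vertex_degree S u) else 0) - adj S u v"

text \<open>Eigenvalues of a matrix whose rows and columns are indexed by a finite set \<open>V\<close>, with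
  (algebraic) multiplicity. The rows and columns are put in an arbitrary order; a different order
  gives a similar matrix. Only real roots are counted, which is all of them for the symmetric
  matrices considered here.\<close>

definition matrix_in_order :: "'v list \<Rightarrow> ('v \<Rightarrow> 'v \<Rightarrow> real) \<Rightarrow> real mat" where
  "matrix_in_order vs M = mat (length vs) (length vs) (\<lambda>(i, j). M (vs ! i) (vs ! j))"

definition eigenvalues_on :: "'v set \<Rightarrow> ('v \<Rightarrow> 'v \<Rightarrow> real) \<Rightarrow> real multiset" where
  "eigenvalues_on V M =
     proots (char_poly (matrix_in_order (SOME vs. distinct vs \<and> set vs = V) M))"

definition eigenvalues :: "'v sgraph \<Rightarrow> real multiset" where
  "eigenvalues S = eigenvalues_on (verts S) (adj S)"

definition laplacian_eigenvalues :: "'v sgraph \<Rightarrow> real multiset" where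
  "laplacian_eigenvalues S = eigenvalues_on (verts S) (laplacian S)"

text \<open>Erratum. The source prints the common value of the two energies of the toroidal line graph as
  \<open>4mn + 2 \<Sum>\<Sum>\<bar>\<dots>\<bar>\<close>. With the energies as defined here, and with the eigenvalues the source lists
  (and which are correct), the eigenvalue \<open>2\<close> of additional multiplicity \<open>mn\<close> contributes \<open>2mn\<close>, so
  the first term has to be \<open>2mn\<close>; the theorem is stated with \<open>2mn\<close>. For \<open>m = n = 3\<close>, \<open>r\<^sub>1 = r\<^sub>2 = 0\<close>
  the energy is \<open>40\<close>, whereas the printed formula gives \<open>58\<close>.\<close>

definition energy :: "'v sgraph \<Rightarrow> real" where
  "energy S = (\<Sum>x\<in>#eigenvalues S. \<bar>x\<bar>)"

definition average_degree :: "'v sgraph \<Rightarrow> real" where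
  "average_degree S = 2 * real (card (edges S)) / real (card (verts S))"

definition laplacian_energy :: "'v sgraph \<Rightarrow> real" where
  "laplacian_energy S = (\<Sum>x\<in>#laplacian_eigenvalues S. \<bar>x - average_degree S\<bar>)"

definition signed_cycle :: "nat \<Rightarrow> nat \<Rightarrow> 'v sgraph \<Rightarrow> bool" where
  "signed_cycle m r S \<longleftrightarrow>
     signed_graph S \<and> m \<ge> 3 \<and>
     (\<exists>vs. distinct vs \<and> length vs = m \<and> verts S = set vs \<and>
           edges S = {{vs ! i, vs ! (Suc i mod m)} | i. i < m}) \<and>
     card {e \<in> edges S. sig S e = -1} = r"

text \<open>An edge \<open>x\<close> of the product either projects onto an edge of the first factor (and a single
  vertex of the second) or conversely; the signature distinguishes the two cases.\<close>

definition cart_prod :: "'a sgraph \<Rightarrow> 'b sgraph \<Rightarrow> ('a \<times> 'b) sgraph" where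
  "cart_prod S T =
     \<lparr> verts = verts S \<times> verts T,
       edges = {{(u, v), (u', v)} | u u' v. {u, u'} \<in> edges S \<and> v \<in> verts T} \<union>
               {{(u, v), (u, v')} | u v v'. u \<in> verts S \<and> {v, v'} \<in> edges T},
       sig = (\<lambda>x. if fst ` x \<in> edges S then sig S (fst ` x) else sig T (snd ` x)) \<rparr>"

definition incidence_matrix :: "'v sgraph \<Rightarrow> ('v \<Rightarrow> 'v set \<Rightarrow> int) \<Rightarrow> bool" where
  "incidence_matrix S H \<longleftrightarrow>
     (\<forall>v\<in>verts S. \<forall>e\<in>edges S. (v \<notin> e \<longrightarrow> H v e = 0) \<and> (v \<in> e \<longrightarrow> H v e \<in> {1, -1})) \<and>
     (\<forall>u v. {u, v} \<in> edges S \<longrightarrow> H u {u, v} * H v {u, v} = - sig S {u, v})"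

text \<open>The sign of the line graph edge \<open>{e, f}\<close> is the off-diagonal \<open>(e, f)\<close> entry of
  \<open>2I - H\<^sup>T H\<close>; see \<open>adj_line_graph\<close> below.\<close>

definition line_graph :: "'v sgraph \<Rightarrow> ('v \<Rightarrow> 'v set \<Rightarrow> int) \<Rightarrow> 'v set sgraph" where
  "line_graph S H =
     \<lparr> verts = edges S,
       edges = {{e, f} | e f. e \<in> edges S \<and> f \<in> edges S \<and> e \<noteq> f \<and> e \<inter> f \<noteq> {}},
       sig = (\<lambda>x. - (\<Sum>v\<in>verts S. \<Prod>e\<in>x. H v e)) \<rparr>"

lemma signed_graph_edgeD:
  assumes "signed_graph S" "{u, v} \<in> edges S"
  shows "u \<noteq> v" "u \<in> verts S" "v \<in> verts S"
proof -
  have "card {u, v} = 2" "{u, v} \<subseteq> verts S"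
    using assms unfolding signed_graph_def by blast+
  then show "u \<noteq> v" "u \<in> verts S" "v \<in> verts S" by auto
qed

lemma signed_graph_cart_prod:
  assumes S: "signed_graph S" and T: "signed_graph T"
  shows "signed_graph (cart_prod S T)"
proof -
  have fin: "finite (verts S \<times> verts T)" using S T by (simp add: signed_graph_def)
  have sS: "sig S e \<in> {1, -1}" if "e \<in> edges S" for e using S that by (simp add: signed_graph_def)
  have sT: "sig T e \<in> {1, -1}" if "e \<in> edges T" for e using T that by (simp add: signed_graph_def)
  have c: "card e = 2" if "e \<in> edges S" for e using S that by (simp add: signed_graph_def)
  have "x \<subseteq> verts S \<times> verts T \<and> card x = 2 \<and> sig (cart_prod S T) x \<in> {1, -1}"
    if x: "x \<in> edges (cart_prod S T)" for x
  proof -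
    consider u u' v where "x = {(u, v), (u', v)}" "{u, u'} \<in> edges S" "v \<in> verts T"
      | u v v' where "x = {(u, v), (u, v')}" "u \<in> verts S" "{v, v'} \<in> edges T"
      using x by (auto simp: cart_prod_def)
    then show ?thesis
    proof cases
      case 1
      then show ?thesis
        using signed_graph_edgeD[OF S 1(2)] sS[OF 1(2)] by (auto simp: cart_prod_def)
    next
      case 2
      have "{u} \<notin> edges S" using c[of "{u}"] by auto
      then show ?thesis
        using 2 signed_graph_edgeD[OF T 2(3)] sT[OF 2(3)] by (auto simp: cart_prod_def)
    qed
  qed
  then show ?thesis using fin by (auto simp: signed_graph_def cart_prod_def)
qed

lemma adj_line_graph:
  assumes S: "signed_graph S" and H: "incidence_matrix S H"
    and e: "e \<in> edges S" and f: "f \<in> edges S"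
  shows "adj (line_graph S H) e f =
    (if e = f then 2 else 0) - (\<Sum>v\<in>verts S. real_of_int (H v e) * real_of_int (H v f))"
proof (cases "e = f")
  case True
  have fin: "finite (verts S)" and sub: "e \<subseteq> verts S" and "card e = 2"
    using S e by (auto simp: signed_graph_def)
  have "real_of_int (H v e) * real_of_int (H v e) = (if v \<in> e then 1 else 0)"
    if "v \<in> verts S" for v
    using H e that unfolding incidence_matrix_def by fastforce
  then have "(\<Sum>v\<in>verts S. real_of_int (H v e) * real_of_int (H v e)) =
      (\<Sum>v\<in>verts S. if v \<in> e then 1 else 0)"
    by (rule sum.cong[OF refl])
  also have "\<dots> = real (card (verts S \<inter> e))" using fin by (simp add: sum.If_cases)
  also have "\<dots> = 2" using sub \<open>card e = 2\<close> by (simp add: Int_absorb1)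
  finally show ?thesis using True by (auto simp: adj_def line_graph_def doubleton_eq_iff)
next
  case False
  show ?thesis
  proof (cases "e \<inter> f = {}")
    case True
    have "H v e * H v f = 0" if "v \<in> verts S" for v
    proof -
      have "v \<notin> e \<or> v \<notin> f" using True by blast
      then show ?thesis using H e f that unfolding incidence_matrix_def by auto
    qed
    then have "(\<Sum>v\<in>verts S. real_of_int (H v e) * real_of_int (H v f)) = 0"
      by (intro sum.neutral) (metis mult_eq_0_iff of_int_eq_0_iff)
    then show ?thesis using True False
      by (auto simp: adj_def line_graph_def doubleton_eq_iff)
  next
    case ne: False
    have "{e, f} \<in> edges (line_graph S H)" using ne False e f by (auto simp: line_graph_def)
    then show ?thesis using False by (simp add: adj_def) (simp add: line_graph_def)
  qed
qed

lemma signed_graph_line_graph: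
  assumes S: "signed_graph S" and H: "incidence_matrix S H"
  shows "signed_graph (line_graph S H)"
proof -
  have fin: "finite (verts S)" using S by (simp add: signed_graph_def)
  have "edges S \<subseteq> Pow (verts S)" using S by (auto simp: signed_graph_def)
  then have finE: "finite (edges S)" using fin by (meson finite_Pow_iff finite_subset)
  have "sig (line_graph S H) {e, f} \<in> {1, -1}"
    if e: "e \<in> edges S" and f: "f \<in> edges S" and ne: "e \<noteq> f" "e \<inter> f \<noteq> {}" for e f
  proof -
    obtain w where w: "w \<in> e" "w \<in> f" using ne by blast
    have ce: "card e = 2" "card f = 2" "e \<subseteq> verts S" using S e f by (auto simp: signed_graph_def)
    have wV: "w \<in> verts S" using ce w by blast
    have uniq: "v = w" if "v \<in> e" "v \<in> f" for v
    proof (rule ccontr)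
      assume "v \<noteq> w"
      then have "e = {v, w}" "f = {v, w}"
        using that w ce by (auto simp: card_2_iff)
      then show False using ne by simp
    qed
    have "(\<Sum>v\<in>verts S. H v e * H v f) = (\<Sum>v\<in>{w}. H v e * H v f)"
    proof (rule sum.mono_neutral_right[OF fin])
      show "{w} \<subseteq> verts S" using wV by simp
      show "\<forall>v\<in>verts S - {w}. H v e * H v f = 0"
      proof
        fix v assume v: "v \<in> verts S - {w}"
        then have "v \<notin> e \<or> v \<notin> f" using uniq by blast
        then show "H v e * H v f = 0" using v H e f unfolding incidence_matrix_def by auto
      qed
    qed
    moreover have "H w e \<in> {1, -1}" "H w f \<in> {1, -1}"
      using H e f w wV unfolding incidence_matrix_def by blast+
    ultimately show ?thesis using ne by (auto simp: line_graph_def)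
  qed
  note sg = this
  have "card x = 2 \<and> x \<subseteq> edges S \<and> sig (line_graph S H) x \<in> {1, -1}"
    if x: "x \<in> edges (line_graph S H)" for x
  proof -
    obtain e f where "x = {e, f}" "e \<in> edges S" "f \<in> edges S" "e \<noteq> f" "e \<inter> f \<noteq> {}"
      using x unfolding line_graph_def by auto
    then show ?thesis using sg[of e f] by simp
  qed
  moreover have "verts (line_graph S H) = edges S" by (simp add: line_graph_def)
  ultimately show ?thesis using finE by (simp add: signed_graph_def)
qed

end

(* With A the adjacency matrix of the toroidal grid, H H^T = 4 I - A, because the grid is 4-regular,
   while the 6-regular line graph has adjacency matrix 2 I - H^T H and hence Laplacian matrix
   4 I + H^T H. Since H H^T and H^T H have the same characteristic polynomial up to a power of the
   indeterminate, everything follows from the spectrum of the grid, which consists of the sums of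
   the eigenvalues of the two signed cycles. *)

theory Submission
  imports Defs
begin

text \<open>Eigenvalues are counted with algebraic multiplicity, as roots of a characteristic
  polynomial taken in an unspecified enumeration of the vertices. The spectra of cycle and grid are
  therefore carried as orthogonal eigenbases indexed by sets: these mention no enumeration, are
  stable under affine changes and Kronecker sums, and determine the characteristic polynomial in
  every enumeration. The natural eigenvectors of a signed cycle are complex, so the diagonalisation
  is done over the complex numbers and the resulting identity of polynomials is brought back to real
  coefficients. Both matrices of the line graph have the form a I + b H^T H, with (a, b) = (2, -1)
  for the adjacency matrix and (4, 1) for the Laplacian. One statement about such matrices serves
  both, and a is the eigenvalue whose additional multiplicity is |E| - |V| = 2mn - mn. The energies
  coincide because L = 6 I - A for the 6-regular line graph.\<close>

section \<open>Characteristic polynomials of a I + BC and a I + CB\<close>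

text \<open>The shift by a I replaces the indeterminate x by y = x - a, which reduces the claim to
  Sylvester's identity y^p det(y I - CB) = y^q det(y I - BC). Cross-multiplied powers avoid division
  and a case distinction on the sizes p and q.\<close>

lemma char_poly_swap_mult:
  fixes B C :: "'a :: idom mat"
  assumes B: "B \<in> carrier_mat p q" and C: "C \<in> carrier_mat q p"
  shows "[:-a, 1:] ^ p * char_poly (a \<cdot>\<^sub>m 1\<^sub>m q + C * B) =
         [:-a, 1:] ^ q * char_poly (a \<cdot>\<^sub>m 1\<^sub>m p + B * C)"
proof -
  define y where "y = [:-a, 1:]"
  define P where "P = map_mat (\<lambda>x. [:x:]) B"
  define Q where "Q = map_mat (\<lambda>x. [:x:]) C"
  have P: "P \<in> carrier_mat p q" and Q: "Q \<in> carrier_mat q p"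
    using B C by (auto simp: P_def Q_def)
  interpret const: comm_ring_hom "\<lambda>x::'a. [:x:]"
    by unfold_locales (auto simp: one_pCons)
  have QP: "Q * P = map_mat (\<lambda>x. [:x:]) (C * B)" and PQ: "P * Q = map_mat (\<lambda>x. [:x:]) (B * C)"
    unfolding P_def Q_def using const.mat_hom_mult[OF C B] const.mat_hom_mult[OF B C] by simp_all
  have cp: "char_poly (a \<cdot>\<^sub>m 1\<^sub>m k + X) = det (y \<cdot>\<^sub>m 1\<^sub>m k - map_mat (\<lambda>x. [:x:]) X)"
    if X: "X \<in> carrier_mat k k" for k and X :: "'a mat"
    unfolding char_poly_def char_poly_matrix_def y_def
    by (rule arg_cong[of _ _ det], rule eq_matI) (use X in auto)
  \<comment> \<open>The determinant of \<open>N\<close> is computed from the Schur complements of both diagonal blocks.\<close>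
  define N where "N = four_block_mat (y \<cdot>\<^sub>m 1\<^sub>m p) P Q (1\<^sub>m q)"
  have N: "N \<in> carrier_mat (p + q) (p + q)" unfolding N_def using P Q by auto
  have "det N * det (four_block_mat (1\<^sub>m p) (0\<^sub>m p q) (-Q) (1\<^sub>m q)) = det (y \<cdot>\<^sub>m 1\<^sub>m p - P * Q)"
  proof -
    have "N * four_block_mat (1\<^sub>m p) (0\<^sub>m p q) (-Q) (1\<^sub>m q) =
          four_block_mat (y \<cdot>\<^sub>m 1\<^sub>m p - P * Q) P (0\<^sub>m q p) (1\<^sub>m q)"
      unfolding N_def
      by (subst mult_four_block_mat[of _ p p _ q _ q _ _ p _ q])
        (use P Q in \<open>auto simp: minus_add_uminus_mat[of _ p p]\<close>)
    then have "det (N * four_block_mat (1\<^sub>m p) (0\<^sub>m p q) (-Q) (1\<^sub>m q)) = det (y \<cdot>\<^sub>m 1\<^sub>m p - P * Q)"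
      using det_four_block_mat_lower_left_zero[of "y \<cdot>\<^sub>m 1\<^sub>m p - P * Q" p P q "0\<^sub>m q p" "1\<^sub>m q"] P Q
        minus_carrier_mat[of "P * Q" p p "y \<cdot>\<^sub>m 1\<^sub>m p"]
      by simp
    then show ?thesis
      using det_mult[OF N, of "four_block_mat (1\<^sub>m p) (0\<^sub>m p q) (-Q) (1\<^sub>m q)"] Q by auto
  qed
  \<comment> \<open>Clearing \<open>P\<close> with the block \<open>y I\<close> directly would
    require an inverse of \<open>y\<close>. The right factor scales the last q columns by
    \<open>y\<close> instead, and its determinant is the source of \<open>y ^ q\<close>.\<close>
  moreover have "det N * det (four_block_mat (1\<^sub>m p) (-P) (0\<^sub>m q p) (y \<cdot>\<^sub>m 1\<^sub>m q)) =
      y ^ p * det (y \<cdot>\<^sub>m 1\<^sub>m q - Q * P)"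
  proof -
    have e1: "y \<cdot>\<^sub>m 1\<^sub>m p * (-P) + P * (y \<cdot>\<^sub>m 1\<^sub>m q) = 0\<^sub>m p q"
      by (rule eq_matI)
        (use P in \<open>auto simp: mult_smult_distrib[of _ p q] mult_smult_assoc_mat[of _ p p _ q]\<close>)
    have e2: "Q * (-P) + y \<cdot>\<^sub>m 1\<^sub>m q = y \<cdot>\<^sub>m 1\<^sub>m q - Q * P"
      by (rule eq_matI) (use P Q in auto)
    have eq: "N * four_block_mat (1\<^sub>m p) (-P) (0\<^sub>m q p) (y \<cdot>\<^sub>m 1\<^sub>m q) =
          four_block_mat (y \<cdot>\<^sub>m 1\<^sub>m p) (0\<^sub>m p q) Q (y \<cdot>\<^sub>m 1\<^sub>m q - Q * P)"
      unfolding N_def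
      by (subst mult_four_block_mat[of _ p p _ q _ q _ _ p _ q]) (use P Q e1 e2 in auto)
    have "det (N * four_block_mat (1\<^sub>m p) (-P) (0\<^sub>m q p) (y \<cdot>\<^sub>m 1\<^sub>m q)) =
        y ^ p * det (y \<cdot>\<^sub>m 1\<^sub>m q - Q * P)"
      unfolding eq
      by (subst det_four_block_mat_upper_right_zero[of _ p _ q]) (use P Q in \<open>auto simp: det_smult\<close>)
    then show ?thesis
      using det_mult[OF N, of "four_block_mat (1\<^sub>m p) (-P) (0\<^sub>m q p) (y \<cdot>\<^sub>m 1\<^sub>m q)"] P by auto
  qed
  moreover have "det (four_block_mat (1\<^sub>m p) (0\<^sub>m p q) (-Q) (1\<^sub>m q)) = 1"
    by (subst det_four_block_mat_upper_right_zero[of _ p _ q]) (use Q in auto)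
  moreover have "det (four_block_mat (1\<^sub>m p) (-P) (0\<^sub>m q p) (y \<cdot>\<^sub>m 1\<^sub>m q)) = y ^ q"
    by (subst det_four_block_mat_lower_left_zero[of _ p _ q]) (use P in \<open>auto simp: det_smult\<close>)
  ultimately have "y ^ p * det (y \<cdot>\<^sub>m 1\<^sub>m q - Q * P) = y ^ q * det (y \<cdot>\<^sub>m 1\<^sub>m p - P * Q)"
    by (simp add: mult.commute)
  then show ?thesis
    using B C by (simp add: cp QP PQ y_def)
qed

lemma sum_set_conv_nth:
  assumes "distinct xs"
  shows "(\<Sum>x\<in>set xs. f x) = (\<Sum>i<length xs. f (xs ! i))"
  using sum_list_distinct_conv_sum_set[OF assms, of f] 
  by (simp add: sum_list_sum_nth atLeast0LessThan)

text \<open>With B the matrix of \<open>h\<close> and C = b B^T, the two matrices are a I + CB and a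
  I + BC. The scalar \<open>b\<close> is absorbed into one factor, so that negative multiples of a
  Gram matrix are covered as well.\<close>

lemma char_poly_gram:
  fixes h :: "'v \<Rightarrow> 'e \<Rightarrow> real"
  assumes vs: "distinct vs" and es: "distinct es"
  shows "[:-a, 1:] ^ length vs *
      char_poly (matrix_in_order es
        (\<lambda>e f. (if e = f then a else 0) + b * (\<Sum>v\<in>set vs. h v e * h v f))) =
    [:-a, 1:] ^ length es *
      char_poly (matrix_in_order vs
        (\<lambda>u v. (if u = v then a else 0) + b * (\<Sum>e\<in>set es. h u e * h v e)))"
proof -
  define p q where "p = length vs" and "q = length es"
  define B where "B = mat p q (\<lambda>(i, j). h (vs ! i) (es ! j))"
  define C where "C = mat q p (\<lambda>(i, j). b * h (vs ! j) (es ! i))"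
  have "matrix_in_order es
        (\<lambda>e f. (if e = f then a else 0) + b * (\<Sum>v\<in>set vs. h v e * h v f)) = a \<cdot>\<^sub>m 1\<^sub>m q + C * B"
    by (rule eq_matI)
      (auto simp: matrix_in_order_def B_def C_def p_def q_def scalar_prod_def sum_set_conv_nth[OF vs]
        nth_eq_iff_index_eq[OF es] atLeast0LessThan sum_distrib_left mult_ac intro!: sum.cong)
  moreover have "matrix_in_order vs
        (\<lambda>u v. (if u = v then a else 0) + b * (\<Sum>e\<in>set es. h u e * h v e)) = a \<cdot>\<^sub>m 1\<^sub>m p + B * C"
    by (rule eq_matI)
      (auto simp: matrix_in_order_def B_def C_def p_def q_def scalar_prod_def sum_set_conv_nth[OF es]
        nth_eq_iff_index_eq[OF vs] atLeast0LessThan sum_distrib_left mult_ac intro!: sum.cong)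
  ultimately show ?thesis
    using char_poly_swap_mult[of B p q C a] by (simp add: p_def q_def B_def C_def)
qed

section \<open>Orthogonal eigenbases and their characteristic polynomials\<close>

text \<open>Since all vectors have the same squared norm \<open>c\<close>, the inverse of the matrix
  \<open>P\<close> of eigenvectors is explicit: its conjugate transpose divided by \<open>c\<close>.
  Hence the matrix is similar over the complex numbers to a diagonal one. Both polynomials have real
  coefficients, and the embedding of the reals is injective.\<close>

lemma char_poly_orthogonal_eigenvectors:
  fixes M :: "'v \<Rightarrow> 'v \<Rightarrow> real" and F :: "'i \<Rightarrow> 'v \<Rightarrow> complex" and \<mu> :: "'i \<Rightarrow> real"
  assumes vs: "distinct vs" and I: "finite I" "card I = length vs" and c: "c \<noteq> 0"
    and eig: "\<And>i u. i \<in> I \<Longrightarrow> u \<in> set vs \<Longrightarrow>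
      (\<Sum>v\<in>set vs. of_real (M u v) * F i v) = of_real (\<mu> i) * F i u"
    and orth: "\<And>i j. i \<in> I \<Longrightarrow> j \<in> I \<Longrightarrow>
      (\<Sum>v\<in>set vs. F i v * cnj (F j v)) = (if i = j then c else 0)"
  shows "char_poly (matrix_in_order vs M) = (\<Prod>i\<in>I. [:-\<mu> i, 1:])"
proof -
  interpret poly_hom: map_poly_comm_ring_hom complex_of_real ..
  define p where "p = length vs"
  obtain js where js: "distinct js" "set js = I" using finite_distinct_list[OF I(1)] by blast
  have len: "length js = p" using I js distinct_card[of js] by (simp add: p_def)
  have mem: "i < p \<Longrightarrow> js ! i \<in> I" "i < p \<Longrightarrow> vs ! i \<in> set vs" for i
    using js len p_def by auto
  define A where "A = map_mat complex_of_real (matrix_in_order vs M)"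
  define P where "P = mat p p (\<lambda>(i, j). F (js ! j) (vs ! i))"
  define Q where "Q = mat p p (\<lambda>(i, j). cnj (F (js ! i) (vs ! j)) / c)"
  define D where "D = mat p p (\<lambda>(i, j). if i = j then complex_of_real (\<mu> (js ! i)) else 0)"
  have carr: "A \<in> carrier_mat p p" "D \<in> carrier_mat p p" "P \<in> carrier_mat p p" "Q \<in> carrier_mat p p"
    by (auto simp: A_def D_def P_def Q_def p_def matrix_in_order_def)
  have QP: "Q * P = 1\<^sub>m p"
  proof (rule eq_matI)
    fix i j assume ij: "i < dim_row (1\<^sub>m p :: complex mat)" "j < dim_col (1\<^sub>m p :: complex mat)"
    then have "(Q * P) $$ (i, j) = (\<Sum>k<p. F (js ! j) (vs ! k) * cnj (F (js ! i) (vs ! k))) / c"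
      by (simp add: Q_def P_def scalar_prod_def atLeast0LessThan sum_divide_distrib mult.commute)
    also have "\<dots> = 1\<^sub>m p $$ (i, j)"
      using orth[of "js ! j" "js ! i"] ij c mem
      by (auto simp: sum_set_conv_nth[OF vs] p_def[symmetric] nth_eq_iff_index_eq[OF js(1)] len)
    finally show "(Q * P) $$ (i, j) = 1\<^sub>m p $$ (i, j)" .
  qed (auto simp: Q_def P_def)
  have PQ: "P * Q = 1\<^sub>m p" by (rule mat_mult_left_right_inverse[OF carr(4,3) QP])
  have AP: "A * P = P * D"
  proof (rule eq_matI)
    fix i j assume ij: "i < dim_row (P * D)" "j < dim_col (P * D)"
    then have ij': "i < p" "j < p" using carr by auto
    have "(A * P) $$ (i, j) = (\<Sum>k<p. of_real (M (vs ! i) (vs ! k)) * F (js ! j) (vs ! k))"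
      using ij' by (simp add: A_def P_def matrix_in_order_def scalar_prod_def atLeast0LessThan p_def)
    also have "\<dots> = of_real (\<mu> (js ! j)) * F (js ! j) (vs ! i)"
      using eig[of "js ! j" "vs ! i"] ij' mem by (simp add: sum_set_conv_nth[OF vs] p_def[symmetric])
    also have "\<dots> = (P * D) $$ (i, j)"
      using ij' by (simp add: P_def D_def scalar_prod_def if_distrib[of "\<lambda>x. _ * x"] cong: if_cong)
    finally show "(A * P) $$ (i, j) = (P * D) $$ (i, j)" .
  qed (use carr in auto)
  have "A = A * (P * Q)" using carr PQ by simp
  also have "\<dots> = P * D * Q" using carr AP by (metis assoc_mult_mat)
  finally have "similar_mat A D"
    using carr PQ QP by (intro similar_matI[of A D P Q p]) auto
  then have "char_poly A = char_poly D" by (rule char_poly_similar)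
  also have "\<dots> = (\<Prod>a\<leftarrow>diag_mat D. [:-a, 1:])"
    by (rule char_poly_upper_triangular[of D p]) (auto simp: D_def)
  also have "diag_mat D = map (\<lambda>i. complex_of_real (\<mu> i)) js"
    by (rule nth_equalityI) (auto simp: diag_mat_def D_def len)
  also have "(\<Prod>a\<leftarrow>map (\<lambda>i. complex_of_real (\<mu> i)) js. [:-a, 1:]) = (\<Prod>i\<in>I. [:-complex_of_real (\<mu> i), 1:])"
    using prod.distinct_set_conv_list[OF js(1), of "\<lambda>i. [:-complex_of_real (\<mu> i), 1:]"] js(2)
    by (simp add: o_def)
  also have "\<dots> = map_poly complex_of_real (\<Prod>i\<in>I. [:-\<mu> i, 1:])"
    by (simp add: poly_hom.hom_prod)
  finally have "map_poly complex_of_real (char_poly (matrix_in_order vs M)) =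
      map_poly complex_of_real (\<Prod>i\<in>I. [:-\<mu> i, 1:])"
    unfolding A_def by (subst (asm) of_real_hom.char_poly_hom[of _ p])
      (auto simp: matrix_in_order_def p_def)
  then show ?thesis by (simp add: poly_eq_iff coeff_map_poly)
qed

text \<open>Orthogonality with a common nonzero norm makes the family independent, and the equality
  of cardinalities makes it a basis. Indexing by \<open>I\<close> rather than by eigenvalue records
  multiplicities, since \<mu> may repeat values.\<close>

definition orthogonal_eigenbasis ::
    "'v set \<Rightarrow> ('v \<Rightarrow> 'v \<Rightarrow> real) \<Rightarrow> 'i set \<Rightarrow> ('i \<Rightarrow> 'v \<Rightarrow> complex) \<Rightarrow> ('i \<Rightarrow> real) \<Rightarrow> bool"
  where
  "orthogonal_eigenbasis V M I F \<mu> \<longleftrightarrow>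
     finite I \<and> card I = card V \<and>
     (\<forall>i\<in>I. \<forall>u\<in>V. (\<Sum>v\<in>V. of_real (M u v) * F i v) = of_real (\<mu> i) * F i u) \<and>
     (\<exists>c. c \<noteq> 0 \<and> (\<forall>i\<in>I. \<forall>j\<in>I. (\<Sum>v\<in>V. F i v * cnj (F j v)) = (if i = j then c else 0)))"

lemma char_poly_eigenbasis:
  assumes "distinct vs" "orthogonal_eigenbasis (set vs) M I F \<mu>"
  shows "char_poly (matrix_in_order vs M) = (\<Prod>i\<in>I. [:-\<mu> i, 1:])"
proof -
  obtain c where "c \<noteq> 0"
      "\<And>i j. i \<in> I \<Longrightarrow> j \<in> I \<Longrightarrow> (\<Sum>v\<in>set vs. F i v * cnj (F j v)) = (if i = j then c else 0)"
    using assms(2) unfolding orthogonal_eigenbasis_def by blast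
  then show ?thesis
    using assms distinct_card[OF assms(1)] unfolding orthogonal_eigenbasis_def
    by (intro char_poly_orthogonal_eigenvectors[of vs I c]) auto
qed

lemma orthogonal_eigenbasis_cong:
  assumes "orthogonal_eigenbasis V M I F \<mu>" "\<And>u v. u \<in> V \<Longrightarrow> v \<in> V \<Longrightarrow> M u v = M' u v"
    and "\<And>i. i \<in> I \<Longrightarrow> \<mu> i = \<mu>' i"
  shows "orthogonal_eigenbasis V M' I F \<mu>'"
  using assms unfolding orthogonal_eigenbasis_def by auto

lemma orthogonal_eigenbasis_affine:
  assumes "orthogonal_eigenbasis V M I F \<mu>" "finite V"
  shows "orthogonal_eigenbasis V (\<lambda>u v. (if u = v then a else 0) + b * M u v) I F (\<lambda>i. a + b * \<mu> i)"
proof -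
  have "(\<Sum>v\<in>V. of_real ((if u = v then a else 0) + b * M u v) * F i v) =
      of_real (a + b * \<mu> i) * F i u" if "i \<in> I" "u \<in> V" for i u
  proof -
    have "(\<Sum>v\<in>V. of_real ((if u = v then a else 0) + b * M u v) * F i v) =
        (\<Sum>v\<in>V. (if u = v then of_real a * F i v else 0)) + of_real b * (\<Sum>v\<in>V. of_real (M u v) * F i v)"
      unfolding sum_distrib_left sum.distrib[symmetric] by (rule sum.cong) (auto simp: algebra_simps)
    also have "\<dots> = of_real (a + b * \<mu> i) * F i u"
      using assms that by (simp add: orthogonal_eigenbasis_def algebra_simps)
    finally show ?thesis .
  qed
  then show ?thesis using assms(1) unfolding orthogonal_eigenbasis_def by auto
qed

text \<open>The matrix is the Kronecker sum of M and N, and tensor products of eigenvectors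
  diagonalise it. Inner products over V \<times> W factor, so orthogonality is inherited and the
  common norm becomes \<open>c * d\<close>.\<close>

lemma orthogonal_eigenbasis_kronecker_sum:
  assumes F: "orthogonal_eigenbasis V M I F \<mu>" and G: "orthogonal_eigenbasis W N J G \<nu>"
    and fin: "finite V" "finite W"
  shows "orthogonal_eigenbasis (V \<times> W)
    (\<lambda>(u, w) (u', w'). (if w = w' then M u u' else 0) + (if u = u' then N w w' else 0))
    (I \<times> J) (\<lambda>(i, j) (u, w). F i u * G j w) (\<lambda>(i, j). \<mu> i + \<nu> j)"
proof -
  obtain c where c: "c \<noteq> 0"
      "\<And>i j. i \<in> I \<Longrightarrow> j \<in> I \<Longrightarrow> (\<Sum>v\<in>V. F i v * cnj (F j v)) = (if i = j then c else 0)"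
    using F unfolding orthogonal_eigenbasis_def by blast
  obtain d where d: "d \<noteq> 0"
      "\<And>i j. i \<in> J \<Longrightarrow> j \<in> J \<Longrightarrow> (\<Sum>v\<in>W. G i v * cnj (G j v)) = (if i = j then d else 0)"
    using G unfolding orthogonal_eigenbasis_def by blast
  have "(\<Sum>(u', w')\<in>V \<times> W. of_real ((if w = w' then M u u' else 0) + (if u = u' then N w w' else 0))
        * (F i u' * G j w')) = of_real (\<mu> i + \<nu> j) * (F i u * G j w)"
    if "i \<in> I" "j \<in> J" "u \<in> V" "w \<in> W" for i j u w
  proof -
    have "(\<Sum>(u', w')\<in>V \<times> W. of_real ((if w = w' then M u u' else 0) + (if u = u' then N w w' else 0))
        * (F i u' * G j w')) =
      (\<Sum>u'\<in>V. \<Sum>w'\<in>W. (if w = w' then of_real (M u u') * F i u' * G j w' else 0)) +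
      (\<Sum>u'\<in>V. if u = u' then \<Sum>w'\<in>W. of_real (N w w') * F i u' * G j w' else 0)"
      unfolding sum.cartesian_product[symmetric] sum.distrib[symmetric]
      by (intro sum.cong refl) (auto simp: algebra_simps sum.distrib intro!: sum.cong)
    also have "\<dots> = (\<Sum>u'\<in>V. of_real (M u u') * F i u') * G j w +
        F i u * (\<Sum>w'\<in>W. of_real (N w w') * G j w')"
      using fin that by (simp add: sum_distrib_left sum_distrib_right mult_ac)
    also have "\<dots> = of_real (\<mu> i + \<nu> j) * (F i u * G j w)"
      using F G that by (simp add: orthogonal_eigenbasis_def algebra_simps)
    finally show ?thesis .
  qed
  moreover have "(\<Sum>(u, w)\<in>V \<times> W. F i u * G j w * cnj (F i' u * G j' w)) =
      (if (i, j) = (i', j') then c * d else 0)"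
    if "i \<in> I" "j \<in> J" "i' \<in> I" "j' \<in> J" for i j i' j'
  proof -
    have "(\<Sum>(u, w)\<in>V \<times> W. F i u * G j w * cnj (F i' u * G j' w)) =
      (\<Sum>u\<in>V. F i u * cnj (F i' u)) * (\<Sum>w\<in>W. G j w * cnj (G j' w))"
      by (simp add: sum_product sum.cartesian_product mult_ac)
    then show ?thesis using c(2)[of i i'] d(2)[of j j'] that by simp
  qed
  moreover have "c * d \<noteq> 0" using c d by simp
  moreover have "finite (I \<times> J)" "card (I \<times> J) = card (V \<times> W)"
    using F G by (auto simp: orthogonal_eigenbasis_def card_cartesian_product)
  ultimately show ?thesis
    unfolding orthogonal_eigenbasis_def
    by (intro conjI exI[of _ "c * d"]) (simp_all add: split_beta cong: if_cong)
qed

section \<open>Eigenvalue multisets of Gram-type matrices\<close>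

lemma some_enumeration:
  assumes "finite V"
  defines "vs \<equiv> SOME vs. distinct vs \<and> set vs = V"
  shows "distinct vs" "set vs = V"
  using someI_ex[of "\<lambda>vs. distinct vs \<and> set vs = V"] finite_distinct_list[OF assms(1)]
  unfolding vs_def by blast+

lemma eigenvalues_on_cong:
  assumes "finite V" "\<And>u v. u \<in> V \<Longrightarrow> v \<in> V \<Longrightarrow> M u v = M' u v"
  shows "eigenvalues_on V M = eigenvalues_on V M'"
proof -
  define vs where "vs = (SOME vs. distinct vs \<and> set vs = V)"
  have "set vs = V" using some_enumeration[OF assms(1)] by (simp add: vs_def)
  then have "matrix_in_order vs M = matrix_in_order vs M'"
    unfolding matrix_in_order_def by (intro cong_mat) (use assms(2) in auto)
  then show ?thesis by (simp add: eigenvalues_on_def vs_def)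
qed

text \<open>The eigenbasis gives the characteristic polynomial on V in any enumeration, and
  \<open>char_poly_gram\<close> links it to the enumeration of E chosen by
  \<open>eigenvalues_on\<close>. As card V \<le> card E, the common power of x - a cancels and the
  surplus power supplies the extra roots \<open>a\<close>.\<close>

lemma eigenvalues_on_gram:
  fixes h :: "'v \<Rightarrow> 'e \<Rightarrow> real"
  assumes fin: "finite V" "finite E" and le: "card V \<le> card E"
    and F: "orthogonal_eigenbasis V
      (\<lambda>u v. (if u = v then a else 0) + b * (\<Sum>e\<in>E. h u e * h v e)) I F \<nu>"
  shows "eigenvalues_on E (\<lambda>e f. (if e = f then a else 0) + b * (\<Sum>v\<in>V. h v e * h v f)) =
    image_mset \<nu> (mset_set I) + replicate_mset (card E - card V) a"
proof -
  define es where "es = (SOME es. distinct es \<and> set es = E)"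
  have es: "distinct es" "set es = E" using some_enumeration[OF fin(2)] by (simp_all add: es_def)
  obtain vs where vs: "distinct vs" "set vs = V" using finite_distinct_list[OF fin(1)] by blast
  have len: "length vs = card V" "length es = card E" using vs es distinct_card by metis+
  define P where "P = (\<Prod>i\<in>I. [:-\<nu> i, 1:])"
  define X where "X = char_poly (matrix_in_order es
        (\<lambda>e f. (if e = f then a else 0) + b * (\<Sum>v\<in>V. h v e * h v f)))"
  have "[:-a, 1:] ^ card V * X = [:-a, 1:] ^ card E * P"
    using char_poly_gram[OF vs(1) es(1), of a b h]
    unfolding X_def P_def using char_poly_eigenbasis[OF vs(1), unfolded vs(2), OF F]
    by (simp add: vs es len)
  also have "\<dots> = [:-a, 1:] ^ card V * ([:-a, 1:] ^ (card E - card V) * P)"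
    using le by (simp add: power_add[symmetric] mult.assoc[symmetric])
  finally have "X = [:-a, 1:] ^ (card E - card V) * P" by simp
  moreover have "P \<noteq> 0" using F unfolding P_def orthogonal_eigenbasis_def by (simp add: prod_zero_iff)
  moreover have "proots P = image_mset \<nu> (mset_set I)"
    unfolding P_def
    by (subst proots_prod) (simp_all add: sum_unfold_sum_mset)
  ultimately have "proots X = image_mset \<nu> (mset_set I) + replicate_mset (card E - card V) a"
    by (simp add: proots_mult proots_power)
  then show ?thesis by (simp add: eigenvalues_on_def X_def es_def)
qed

section \<open>Degrees, incidence matrices and line graphs\<close>

lemma vertex_degree_eq_card_neighbours:
  assumes "signed_graph S"
  shows "vertex_degree S u = card {v \<in> verts S. {u, v} \<in> edges S}"
proof -
  have "bij_betw (\<lambda>v. {u, v}) {v \<in> verts S. {u, v} \<in> edges S} {e \<in> edges S. u \<in> e}"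
  proof (rule bij_betw_imageI)
    show "inj_on (\<lambda>v. {u, v}) {v \<in> verts S. {u, v} \<in> edges S}"
      by (auto simp: inj_on_def doubleton_eq_iff)
    have "e \<in> (\<lambda>v. {u, v}) ` {v \<in> verts S. {u, v} \<in> edges S}" if e: "e \<in> edges S" "u \<in> e" for e
    proof -
      obtain v where "e = {u, v}" using assms e unfolding signed_graph_def card_2_iff by fastforce
      then show ?thesis using signed_graph_edgeD[OF assms] e by auto
    qed
    then show "(\<lambda>v. {u, v}) ` {v \<in> verts S. {u, v} \<in> edges S} = {e \<in> edges S. u \<in> e}" by auto
  qed
  from bij_betw_same_card[OF this] show ?thesis by (simp add: vertex_degree_def)
qed

lemma finite_edges: "signed_graph S \<Longrightarrow> finite (edges S)"
  by (rule finite_subset[of _ "Pow (verts S)"]) (auto simp: signed_graph_def)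

text \<open>Double counting of incident pairs. For a regular graph this yields the number of edges,
  hence the surplus |E| - |V|, and the average degree.\<close>

lemma sum_vertex_degree:
  assumes "signed_graph S"
  shows "(\<Sum>v\<in>verts S. vertex_degree S v) = 2 * card (edges S)"
proof -
  have fin: "finite (verts S)" "finite (edges S)"
    using assms finite_edges by (auto simp: signed_graph_def)
  have "(\<Sum>v\<in>verts S. vertex_degree S v) = (\<Sum>v\<in>verts S. \<Sum>e\<in>edges S. if v \<in> e then 1 else 0)"
    unfolding vertex_degree_def using fin by (simp add: sum.If_cases Int_def)
  also have "\<dots> = (\<Sum>e\<in>edges S. \<Sum>v\<in>verts S. if v \<in> e then 1 else 0)" by (rule sum.swap)
  also have "\<dots> = (\<Sum>e\<in>edges S. 2)"
  proof (rule sum.cong)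
    fix e assume "e \<in> edges S"
    then have "e \<subseteq> verts S" "card e = 2" using assms by (auto simp: signed_graph_def)
    then show "(\<Sum>v\<in>verts S. if v \<in> e then 1 else 0) = (2::nat)"
      using fin by (simp add: sum.If_cases Int_absorb1)
  qed simp
  finally show ?thesis by simp
qed

text \<open>On the diagonal every incident edge contributes the square of a sign. Off the diagonal
  only the edge {u, v} contains both vertices, and the incidence condition makes its contribution
  minus its sign.\<close>

lemma incidence_gram_eq_laplacian:
  assumes S: "signed_graph S" and H: "incidence_matrix S H" and "u \<in> verts S" "v \<in> verts S"
  shows "(\<Sum>e\<in>edges S. real_of_int (H u e) * real_of_int (H v e)) = laplacian S u v"
proof (cases "u = v")
  case True
  have "real_of_int (H u e) * real_of_int (H u e) = (if u \<in> e then 1 else 0)" if "e \<in> edges S" for e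
    using H assms(3) that unfolding incidence_matrix_def by fastforce
  then have "(\<Sum>e\<in>edges S. real_of_int (H u e) * real_of_int (H v e)) =
      (\<Sum>e\<in>edges S. if u \<in> e then 1 else 0)"
    using True by (intro sum.cong) auto
  also have "\<dots> = real (vertex_degree S u)"
    using finite_edges[OF S] by (simp add: vertex_degree_def sum.If_cases Int_def)
  moreover have "{u} \<notin> edges S" using signed_graph_edgeD(1)[OF S, of u u] by auto
  ultimately show ?thesis using True by (simp add: laplacian_def adj_def)
next
  case False
  have zero: "real_of_int (H u e) * real_of_int (H v e) = 0" if "e \<in> edges S" "e \<noteq> {u, v}" for e
  proof -
    have "card e = 2" using S that by (auto simp: signed_graph_def)
    then have "u \<notin> e \<or> v \<notin> e" using that False by (auto simp: card_2_iff)
    then show ?thesis using H that assms unfolding incidence_matrix_def by auto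
  qed
  show ?thesis
  proof (cases "{u, v} \<in> edges S")
    case True
    have "(\<Sum>e\<in>edges S. real_of_int (H u e) * real_of_int (H v e)) =
        (\<Sum>e\<in>{{u, v}}. real_of_int (H u e) * real_of_int (H v e))"
      using True zero finite_edges[OF S] by (intro sum.mono_neutral_right) auto
    also have "\<dots> = real_of_int (H u {u, v} * H v {u, v})" by simp
    also have "H u {u, v} * H v {u, v} = - sig S {u, v}"
      using H True unfolding incidence_matrix_def by blast
    finally show ?thesis using True False by (simp add: laplacian_def adj_def)
  next
    case no: False
    then have "(\<Sum>e\<in>edges S. real_of_int (H u e) * real_of_int (H v e)) = 0"
      using zero by (intro sum.neutral) blast
    then show ?thesis using no False by (simp add: laplacian_def adj_def)
  qed
qed

text \<open>The stars at u and v share exactly the edge {u, v}, which is counted in both but is not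
  its own neighbour. This accounts for the 2, kept on the left to avoid truncated
  subtraction.\<close>

lemma vertex_degree_line_graph:
  assumes S: "signed_graph S" and H: "incidence_matrix S H" and e: "{u, v} \<in> edges S"
  shows "vertex_degree (line_graph S H) {u, v} + 2 = vertex_degree S u + vertex_degree S v"
proof -
  define N where "N = {f \<in> edges S. f \<noteq> {u, v} \<and> f \<inter> {u, v} \<noteq> {}}"
  let ?U = "{f \<in> edges S. u \<in> f}" and ?V = "{f \<in> edges S. v \<in> f}"
  have uv: "u \<noteq> v" using signed_graph_edgeD[OF S e] by simp
  have "{f \<in> verts (line_graph S H). {{u, v}, f} \<in> edges (line_graph S H)} = N"
    using e unfolding N_def line_graph_def by (auto simp: doubleton_eq_iff)
  then have deg: "vertex_degree (line_graph S H) {u, v} = card N"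
    using vertex_degree_eq_card_neighbours[OF signed_graph_line_graph[OF S H]] by metis
  have "?U \<inter> ?V = {{u, v}}"
  proof
    show "?U \<inter> ?V \<subseteq> {{u, v}}"
    proof
      fix f assume f: "f \<in> ?U \<inter> ?V"
      then have "card f = 2" using S by (auto simp: signed_graph_def)
      then show "f \<in> {{u, v}}" using f uv by (auto simp: card_2_iff)
    qed
  qed (use e in auto)
  moreover have "?U \<union> ?V = insert {u, v} N" "{u, v} \<notin> N" using e unfolding N_def by auto
  moreover have fin: "finite ?U" "finite ?V" "finite N"
    using finite_edges[OF S] by (auto simp: N_def)
  ultimately show ?thesis
    using card_Un_Int[OF fin(1,2)] deg by (simp add: vertex_degree_def)
qed

section \<open>Cartesian products\<close>

lemma edges_cart_prod_iff:
  "{(u, v), (u', v')} \<in> edges (cart_prod S T) \<longleftrightarrow>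
     v = v' \<and> v \<in> verts T \<and> {u, u'} \<in> edges S \<or> u = u' \<and> u \<in> verts S \<and> {v, v'} \<in> edges T"
  (is "?e \<in> _ \<longleftrightarrow> ?R")
proof
  assume "?e \<in> edges (cart_prod S T)"
  then consider a b c where "?e = {(a, c), (b, c)}" "{a, b} \<in> edges S" "c \<in> verts T"
    | a c d where "?e = {(a, c), (a, d)}" "a \<in> verts S" "{c, d} \<in> edges T"
    unfolding cart_prod_def by auto
  then show ?R
  proof cases
    case 1
    then have "{u, u'} = {a, b}" "v = c" "v' = c" by (auto simp: doubleton_eq_iff)
    then show ?thesis using 1 by simp
  next
    case 2
    then have "{v, v'} = {c, d}" "u = a" "u' = a" by (auto simp: doubleton_eq_iff)
    then show ?thesis using 2 by simp
  qed
next
  assume ?R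
  then show "?e \<in> edges (cart_prod S T)" unfolding cart_prod_def by auto
qed

text \<open>The absence of loops keeps the two summands from being nonzero together. It also makes
  the signature choose correctly: if u = u', the first projection of the edge is the singleton {u},
  which is no edge of S, so the sign comes from T.\<close>

lemma adj_cart_prod:
  assumes S: "signed_graph S" and T: "signed_graph T" and "u \<in> verts S" "v \<in> verts T"
  shows "adj (cart_prod S T) (u, v) (u', v') =
    (if v = v' then adj S u u' else 0) + (if u = u' then adj T v v' else 0)"
proof -
  have "{u} \<notin> edges S" "{v} \<notin> edges T" using signed_graph_edgeD(1)[OF S, of u u] signed_graph_edgeD(1)[OF T, of v v] by auto
  moreover have "sig (cart_prod S T) {(u, v), (u', v')} =
      (if {u, u'} \<in> edges S then sig S {u, u'} else sig T {v, v'})"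
    by (simp add: cart_prod_def)
  ultimately show ?thesis
    using assms(3,4) edges_cart_prod_iff[of u v u' v' S T]
    by (cases "u = u'"; cases "v = v'") (simp_all add: adj_def)
qed

lemma vertex_degree_cart_prod:
  assumes S: "signed_graph S" and T: "signed_graph T" and uv: "u \<in> verts S" "v \<in> verts T"
  shows "vertex_degree (cart_prod S T) (u, v) = vertex_degree S u + vertex_degree T v"
proof -
  let ?A = "{u' \<in> verts S. {u, u'} \<in> edges S}" and ?B = "{v' \<in> verts T. {v, v'} \<in> edges T}"
  have no: "{u} \<notin> edges S" using signed_graph_edgeD(1)[OF S, of u u] by auto
  have "{w \<in> verts (cart_prod S T). {(u, v), w} \<in> edges (cart_prod S T)} = ?A \<times> {v} \<union> {u} \<times> ?B"
    using uv by (auto simp: edges_cart_prod_iff) (auto simp: cart_prod_def)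
  moreover have "?A \<times> {v} \<inter> {u} \<times> ?B = {}" using no by auto
  moreover have "finite ?A" "finite ?B" using S T by (auto simp: signed_graph_def)
  ultimately show ?thesis
    using vertex_degree_eq_card_neighbours[OF S] vertex_degree_eq_card_neighbours[OF T]
      vertex_degree_eq_card_neighbours[OF signed_graph_cart_prod[OF S T]]
    by (simp add: card_Un_disjoint card_cartesian_product)
qed

section \<open>Line graphs of regular signed graphs\<close>

text \<open>For degree k, H H^T = k I - A. The line graph has degree 2k - 2, so its Laplacian is (2k
  - 2) I - (2 I - H^T H) = (2k - 4) I + H^T H. The bound k \<ge> 2 ensures |V| \<le> |E|, since k
  |V| = 2 |E|.\<close>

lemma line_graph_spectrum_of_regular:
  assumes S: "signed_graph S" and H: "incidence_matrix S H"
    and reg: "\<And>v. v \<in> verts S \<Longrightarrow> vertex_degree S v = k" and k: "k \<ge> 2"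
    and F: "orthogonal_eigenbasis (verts S) (adj S) I F \<mu>"
  shows "eigenvalues (line_graph S H) =
      image_mset (\<lambda>i. 2 - real k + \<mu> i) (mset_set I) + replicate_mset (card (edges S) - card (verts S)) 2"
    and "laplacian_eigenvalues (line_graph S H) =
      image_mset (\<lambda>i. 3 * real k - 4 - \<mu> i) (mset_set I) +
      replicate_mset (card (edges S) - card (verts S)) (2 * real k - 4)"
proof -
  let ?h = "\<lambda>v e. real_of_int (H v e)"
  have fin: "finite (verts S)" "finite (edges S)"
    using S finite_edges by (auto simp: signed_graph_def)
  have "k * card (verts S) = 2 * card (edges S)"
    using sum_vertex_degree[OF S] reg by (simp add: mult.commute)
  then have le: "card (verts S) \<le> card (edges S)"
    using mult_le_mono1[OF k, of "card (verts S)"] by simp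
  have lap: "(\<Sum>e\<in>edges S. ?h u e * ?h v e) = (if u = v then real k else 0) - adj S u v"
    if "u \<in> verts S" "v \<in> verts S" for u v
    using incidence_gram_eq_laplacian[OF S H that] reg[OF that(1)] reg[OF that(2)] by (simp add: laplacian_def)
  \<comment> \<open>On the vertices, a I + b (k I - A) equals (a + b k) I - b A, an affine function
    of A. The pairs (2, -1) and (2k - 4, 1) are used below.\<close>
  have basis: "orthogonal_eigenbasis (verts S)
      (\<lambda>u v. (if u = v then a else 0) + b * (\<Sum>e\<in>edges S. ?h u e * ?h v e)) I F
      (\<lambda>i. a + b * (real k - \<mu> i))" for a b :: real
    by (rule orthogonal_eigenbasis_cong[OF
          orthogonal_eigenbasis_affine[OF F fin(1), of "a + b * real k" "-b"]])
      (auto simp: lap algebra_simps)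
  have "eigenvalues (line_graph S H) = eigenvalues_on (edges S)
      (\<lambda>e f. (if e = f then 2 else 0) + (-1) * (\<Sum>v\<in>verts S. ?h v e * ?h v f))"
    unfolding eigenvalues_def
    using adj_line_graph[OF S H] fin by (auto simp: line_graph_def intro!: eigenvalues_on_cong)
  also have "\<dots> = image_mset (\<lambda>i. 2 + (-1) * (real k - \<mu> i)) (mset_set I) +
      replicate_mset (card (edges S) - card (verts S)) 2"
    by (rule eigenvalues_on_gram[OF fin le basis])
  finally show "eigenvalues (line_graph S H) =
      image_mset (\<lambda>i. 2 - real k + \<mu> i) (mset_set I) + replicate_mset (card (edges S) - card (verts S)) 2"
    by (simp add: algebra_simps)
  have deg: "real (vertex_degree (line_graph S H) e) = 2 * real k - 2" if e: "e \<in> edges S" for e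
  proof -
    have "card e = 2" using S e by (simp add: signed_graph_def)
    then obtain u v where uv: "e = {u, v}" by (auto simp: card_2_iff)
    then show ?thesis
      using vertex_degree_line_graph[OF S H, of u v] signed_graph_edgeD[OF S, of u v] e reg by simp
  qed
  have "laplacian_eigenvalues (line_graph S H) = eigenvalues_on (edges S)
      (\<lambda>e f. (if e = f then 2 * real k - 4 else 0) + 1 * (\<Sum>v\<in>verts S. ?h v e * ?h v f))"
    unfolding laplacian_eigenvalues_def
    using adj_line_graph[OF S H] deg fin
    by (auto simp: laplacian_def line_graph_def intro!: eigenvalues_on_cong)
  also have "\<dots> = image_mset (\<lambda>i. (2 * real k - 4) + 1 * (real k - \<mu> i)) (mset_set I) +
      replicate_mset (card (edges S) - card (verts S)) (2 * real k - 4)"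
    by (rule eigenvalues_on_gram[OF fin le basis])
  finally show "laplacian_eigenvalues (line_graph S H) =
      image_mset (\<lambda>i. 3 * real k - 4 - \<mu> i) (mset_set I) +
      replicate_mset (card (edges S) - card (verts S)) (2 * real k - 4)"
    by (simp add: algebra_simps)
qed

section \<open>The spectrum of a signed cycle\<close>

lemma prod_signs:
  assumes "finite A" "\<And>x. x \<in> A \<Longrightarrow> f x \<in> {1, -1 :: int}"
  shows "(\<Prod>x\<in>A. f x) = (-1) ^ card {x \<in> A. f x = -1}"
proof -
  have "(\<Prod>x\<in>A. f x) = (\<Prod>x\<in>A. if f x = -1 then -1 else 1)"
    using assms(2) by (intro prod.cong) auto
  then show ?thesis using assms(1) by (simp add: prod.If_cases Int_def)
qed

text \<open>Two distinct indices could name the same edge only if each were the cyclic successor of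
  the other, which would force m to divide 2. The bijection turns the product of signs over the edge
  set into a product along the cycle.\<close>

lemma bij_betw_cyclic_edges:
  assumes "distinct vs" "length vs = m" "m \<ge> 3"
  shows "bij_betw (\<lambda>i. {vs ! i, vs ! (Suc i mod m)}) {..<m} {{vs ! i, vs ! (Suc i mod m)} | i. i < m}"
proof (rule bij_betw_imageI)
  show "inj_on (\<lambda>i. {vs ! i, vs ! (Suc i mod m)}) {..<m}"
  proof (rule inj_onI)
    fix i j assume ij: "i \<in> {..<m}" "j \<in> {..<m}"
      and eq: "{vs ! i, vs ! (Suc i mod m)} = {vs ! j, vs ! (Suc j mod m)}"
    have "Suc i mod m < m" "Suc j mod m < m" using assms by auto
    then have "i = j \<or> i = Suc j mod m \<and> j = Suc i mod m"
      using eq ij assms nth_eq_iff_index_eq[OF assms(1)] by (auto simp: doubleton_eq_iff)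
    then show "i = j" using ij assms(3) by (auto simp: mod_Suc split: if_splits)
  qed
qed auto

text \<open>The predecessor of k is written with \<open>k + (m - 1)\<close> because
  \<open>k - 1\<close> would be truncated at k = 0. It differs from the successor since m \<ge> 3,
  so a sum over neighbours has exactly two terms.\<close>

lemma cyclic_neighbours:
  assumes vs: "distinct vs" "length vs = m" and m: "m \<ge> 3" and k: "k < m"
  shows "{v \<in> set vs. {vs ! k, v} \<in> {{vs ! i, vs ! (Suc i mod m)} | i. i < m}} =
    {vs ! (Suc k mod m), vs ! ((k + (m - 1)) mod m)}" (is "?L = ?R")
    and "vs ! (Suc k mod m) \<noteq> vs ! ((k + (m - 1)) mod m)"
    and "Suc ((k + (m - 1)) mod m) mod m = k"
proof -
  have pv: "(k + (m - 1)) mod m = (if k = 0 then m - 1 else k - 1)"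
  proof (cases "k = 0")
    case False
    then have eq: "k + (m - 1) = (k - 1) + m" using m by simp
    have "(k + (m - 1)) mod m = (k - 1) mod m" unfolding eq by (rule mod_add_self2)
    then show ?thesis using False k by simp
  qed (use m in simp)
  have nx: "Suc k mod m = (if Suc k = m then 0 else Suc k)" using k by (simp add: mod_Suc)
  show pred: "Suc ((k + (m - 1)) mod m) mod m = k" unfolding pv using k m by auto
  show "vs ! (Suc k mod m) \<noteq> vs ! ((k + (m - 1)) mod m)"
  proof -
    have "Suc k mod m < m" "(k + (m - 1)) mod m < m" using m by auto
    moreover have "Suc k mod m \<noteq> (k + (m - 1)) mod m" unfolding pv nx using k m by auto
    ultimately show ?thesis using vs by (simp add: nth_eq_iff_index_eq)
  qed
  have lt: "Suc i mod m < m" "(i + (m - 1)) mod m < m" for i using m by auto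
  show "?L = ?R"
  proof
    show "?L \<subseteq> ?R"
    proof
      fix v assume "v \<in> ?L"
      then obtain i where i: "i < m" "{vs ! k, v} = {vs ! i, vs ! (Suc i mod m)}" by blast
      then consider "vs ! k = vs ! i" "v = vs ! (Suc i mod m)" | "vs ! k = vs ! (Suc i mod m)" "v = vs ! i"
        by (auto simp: doubleton_eq_iff)
      then show "v \<in> ?R"
      proof cases
        case 1
        then show ?thesis using i k vs by (simp add: nth_eq_iff_index_eq)
      next
        case 2
        then have "k = Suc i mod m" using i k vs lt by (simp add: nth_eq_iff_index_eq)
        then have "(k + (m - 1)) mod m = i" using i unfolding pv by (auto simp: mod_Suc)
        then show ?thesis using 2 by simp
      qed
    qed
    define j where "j = (k + (m - 1)) mod m"
    have "{vs ! k, vs ! j} = {vs ! j, vs ! (Suc j mod m)}"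
      unfolding j_def pred by (rule insert_commute)
    moreover have "vs ! j \<in> set vs" "vs ! (Suc k mod m) \<in> set vs" "j < m"
      using lt vs by (auto simp: j_def)
    ultimately show "?R \<subseteq> ?L" using k unfolding j_def[symmetric] by blast
  qed
qed

text \<open>Here \<open>a\<close> is an integer because it stands for differences of indices in the
  orthogonality relations and, with 2m in place of m, for the numerators 2i - [r] of the cycle
  eigenvalues.\<close>

lemma cos_two_pi_int_div_eq_1_iff:
  assumes "m > 0"
  shows "cos (2 * pi * real_of_int a / real m) = 1 \<longleftrightarrow> int m dvd a"
proof -
  have "2 * pi * real_of_int a / real m = real_of_int x * 2 * pi \<longleftrightarrow> a = int m * x" for x
  proof -
    have "2 * pi * real_of_int a / real m = real_of_int x * 2 * pi \<longleftrightarrow>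
        real_of_int a = real_of_int (int m * x)"
      using assms by (simp add: field_simps)
    then show ?thesis by linarith
  qed
  then show ?thesis unfolding cos_one_2pi_int dvd_def by simp
qed

text \<open>Multiplying the discrete Fourier basis by the product of the signs met so far turns the
  signed cycle into a cycle with a sign on the closing edge only, which is absorbed by taking
  \<open>m\<close>-th roots of \<open>(-1)\<^sup>r\<close> in place of \<open>m\<close>-th roots of unity.\<close>

lemma signed_cycle_spectrum:
  assumes C: "signed_cycle m r C"
  shows "\<exists>F. orthogonal_eigenbasis (verts C) (adj C) {1..m} F
      (\<lambda>i. 2 * cos ((2 * real i - of_bool (odd r)) * pi / real m))"
    and "card (verts C) = m" and "v \<in> verts C \<Longrightarrow> vertex_degree C v = 2"
proof -
  obtain vs where S: "signed_graph C" and m: "m \<ge> 3" and vs: "distinct vs" "length vs = m"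
    and V: "verts C = set vs" and E: "edges C = {{vs ! i, vs ! (Suc i mod m)} | i. i < m}"
    and r: "card {e \<in> edges C. sig C e = -1} = r"
    using C unfolding signed_cycle_def by blast
  note nbr = cyclic_neighbours[OF vs m]
  show "card (verts C) = m" using V vs distinct_card by metis
  show "vertex_degree C v = 2" if "v \<in> verts C"
  proof -
    obtain k where "k < m" "v = vs ! k" using \<open>v \<in> verts C\<close> V vs by (auto simp: in_set_conv_nth)
    then show ?thesis
      using nbr(1,2)[of k] unfolding vertex_degree_eq_card_neighbours[OF S] V E by simp
  qed
  define s where "s k = sig C {vs ! k, vs ! (Suc k mod m)}" for k
  have s: "s k \<in> {1, -1}" if "k < m" for k
    using S that unfolding signed_graph_def E s_def by blast
  have s2: "of_int (s k) * of_int (s k) = (1 :: complex)" if "k < m" for k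
    using s[OF that] by auto
  define \<theta> where "\<theta> i = (2 * real i - of_bool (odd r)) * pi / real m" for i
  define t where "t k = (\<Prod>l<k. complex_of_int (s l))" for k
  define g where "g i k = t k * cis (\<theta> i) ^ k" for i k
  have "(\<Prod>l<m. s l) = (\<Prod>e\<in>edges C. sig C e)"
    unfolding E s_def by (rule prod.reindex_bij_betw[OF bij_betw_cyclic_edges[OF vs m]])
  also have "\<dots> = (-1) ^ r"
    using prod_signs[of "edges C" "sig C"] S r finite_edges[OF S] by (auto simp: signed_graph_def)
  finally have prod_s: "(\<Prod>l<m. s l) = (-1) ^ r" .
  have "cis (\<theta> i) ^ m = (-1) ^ r" for i
  proof -
    have "cis (\<theta> i) ^ m = cis ((2 * real i - of_bool (odd r)) * pi)"
      using m by (simp add: DeMoivre \<theta>_def)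
    also have "\<dots> = cis (2 * pi * real i) / cis (of_bool (odd r) * pi)"
      unfolding cis_divide by (simp add: algebra_simps)
    also have "cis (2 * pi * real i) = 1" by (rule cis_multiple_2pi) simp
    also have "1 / cis (of_bool (odd r) * pi) = (-1) ^ r" by simp
    finally show ?thesis .
  qed
  \<comment> \<open>The product of all signs and the m-th power of the root are both (-1)^r and
    cancel. Thus \<open>g i m\<close> equals \<open>g i 0\<close>, which lets the recurrence pass
    over the closing edge.\<close>
  then have g_m: "g i m = 1" for i 
    using prod_s by (simp add: g_def t_def flip: power_mult_distrib of_int_prod)
  have step: "of_int (s k) * g i (Suc k) = cis (\<theta> i) * g i k" if "k < m" for i k
    using s2[OF that] by (simp add: g_def t_def algebra_simps)
  define F where "F i v = g i (the_inv_into {..<m} ((!) vs) v)" for i v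
  have inj: "inj_on ((!) vs) {..<m}" using vs by (simp add: inj_on_nth)
  have F: "F i (vs ! k) = g i k" if "k < m" for i k
    using the_inv_into_f_f[OF inj] that by (simp add: F_def)
  have F_next: "F i (vs ! (Suc k mod m)) = g i (Suc k)" if "k < m" for i k
    using that F[of 0 i] F[of "Suc k" i] g_m m by (cases "Suc k = m") (auto simp: g_def t_def)
  have eig: "(\<Sum>v\<in>verts C. of_real (adj C (vs ! k) v) * F i v) = of_real (2 * cos (\<theta> i)) * F i (vs ! k)"
    if k: "k < m" for i k
  proof -
    \<comment> \<open>The edge to the successor carries the sign \<open>s k\<close> and contributes
      the factor cis \<theta>. The edge to the predecessor \<open>j\<close> carries
      \<open>s j\<close> and contributes cis (-\<theta>). Together they give 2 cos \<theta>.\<close>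
    define j where "j = (k + (m - 1)) mod m"
    have j: "j < m" "Suc j mod m = k" using m nbr(3)[OF k] by (simp_all add: j_def)
    have "(\<Sum>v\<in>verts C. of_real (adj C (vs ! k) v) * F i v) =
        (\<Sum>v\<in>{v \<in> verts C. {vs ! k, v} \<in> edges C}. of_int (sig C {vs ! k, v}) * F i v)"
      using S unfolding adj_def signed_graph_def
      by (simp add: sum.inter_filter if_distrib[of "\<lambda>x. of_real x * _"] cong: if_cong)
    also have "\<dots> = of_int (s k) * F i (vs ! (Suc k mod m)) + of_int (s j) * F i (vs ! j)"
      using nbr(1,2)[OF k] unfolding V E j_def[symmetric] s_def j(2) by (simp add: insert_commute)
    finally have sum: "(\<Sum>v\<in>verts C. of_real (adj C (vs ! k) v) * F i v) =
        of_int (s k) * F i (vs ! (Suc k mod m)) + of_int (s j) * F i (vs ! j)" .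
    have next_term: "of_int (s k) * F i (vs ! (Suc k mod m)) = cis (\<theta> i) * F i (vs ! k)"
      using step[OF k] F[OF k] F_next[OF k] by simp
    have "F i (vs ! k) = g i (Suc j)" using F_next[OF j(1)] j(2) by simp
    then have "of_int (s j) * F i (vs ! k) = cis (\<theta> i) * g i j" using step[OF j(1), of i] by simp
    then have step': "cis (\<theta> i) * g i j = of_int (s j) * F i (vs ! k)" ..
    have "of_int (s j) * g i j = (cis (- \<theta> i) * cis (\<theta> i)) * (of_int (s j) * g i j)"
      by (simp add: cis_mult)
    also have "\<dots> = cis (- \<theta> i) * (of_int (s j) * (cis (\<theta> i) * g i j))" by (simp only: mult_ac)
    also have "\<dots> = cis (- \<theta> i) * ((of_int (s j) * of_int (s j)) * F i (vs ! k))"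
      unfolding step' by (simp only: mult_ac)
    finally have pred_term: "of_int (s j) * F i (vs ! j) = cis (- \<theta> i) * F i (vs ! k)"
      unfolding s2[OF j(1)] F[OF j(1)] by simp
    have "cis (\<theta> i) + cis (- \<theta> i) = of_real (2 * cos (\<theta> i))" by (simp add: complex_eq_iff)
    then show ?thesis
      unfolding sum next_term pred_term by (metis distrib_right)
  qed
  have orth: "(\<Sum>v\<in>verts C. F i v * cnj (F j v)) = (if i = j then of_nat m else 0)"
    if "i \<in> {1..m}" "j \<in> {1..m}" for i j
  proof -
    \<comment> \<open>The parity shift cancels in the difference of the two angles, and the sign
      products cancel against their conjugates. What remains is a geometric sum of powers of the
      m-th root of unity \<open>w\<close>, which differs from 1 when i \<noteq> j because then 0 <
      |i - j| < m.\<close>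
    define w where "w = cis (2 * pi * real_of_int (int i - int j) / real m)"
    have "cis (\<theta> i) * cnj (cis (\<theta> j)) = w"
      by (simp add: w_def cis_cnj cis_mult \<theta>_def diff_divide_distrib[symmetric] algebra_simps)
    moreover have "t k * cnj (t k) = 1" if "k < m" for k
      using that s2 by (simp add: t_def flip: prod.distrib)
    moreover have "g i k * cnj (g j k) = (t k * cnj (t k)) * (cis (\<theta> i) * cnj (cis (\<theta> j))) ^ k" for k
      unfolding g_def complex_cnj_mult complex_cnj_power power_mult_distrib by (simp only: mult_ac)
    ultimately have gg: "g i k * cnj (g j k) = w ^ k" if "k < m" for k
      using that by simp
    have "(\<Sum>v\<in>verts C. F i v * cnj (F j v)) = (\<Sum>k<m. w ^ k)"
      unfolding V sum_set_conv_nth[OF vs(1)] vs(2) using F gg by (intro sum.cong) auto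
    also have "\<dots> = (if i = j then of_nat m else 0)"
    proof (cases "i = j")
      case True
      then show ?thesis by (simp add: w_def)
    next
      case False
      have "w ^ m = cis (2 * pi * real_of_int (int i - int j))"
        using m by (simp add: w_def DeMoivre)
      then have "w ^ m = 1" using cis_multiple_2pi[of "real_of_int (int i - int j)"] by simp
      moreover have "w \<noteq> 1"
      proof
        assume "w = 1"
        then have "cos (2 * pi * real_of_int (int i - int j) / real m) = 1"
          by (metis w_def cis.sel(1) one_complex.sel(1))
        then have "int m dvd int i - int j"
          using cos_two_pi_int_div_eq_1_iff[of m "int i - int j"] m by simp
        then show False using that False zdvd_imp_le[of "int m" "\<bar>int i - int j\<bar>"] by auto
      qed
      ultimately show ?thesis using False by (simp add: geometric_sum)
    qed
    finally show ?thesis .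
  qed
  have "orthogonal_eigenbasis (verts C) (adj C) {1..m} F (\<lambda>i. 2 * cos (\<theta> i))"
    unfolding orthogonal_eigenbasis_def
  proof (intro conjI ballI)
    show "card {1..m} = card (verts C)" using \<open>card (verts C) = m\<close> by simp
    show "\<exists>c. c \<noteq> 0 \<and> (\<forall>i\<in>{1..m}. \<forall>j\<in>{1..m}.
        (\<Sum>v\<in>verts C. F i v * cnj (F j v)) = (if i = j then c else 0))"
      using orth m by (intro exI[of _ "of_nat m"]) auto
    fix i u assume "u \<in> verts C"
    then obtain k where "k < m" "u = vs ! k" using V vs by (auto simp: in_set_conv_nth)
    then show "(\<Sum>v\<in>verts C. of_real (adj C u v) * F i v) = of_real (2 * cos (\<theta> i)) * F i u"
      using eig by simp
  qed simp
  then show "\<exists>F. orthogonal_eigenbasis (verts C) (adj C) {1..m} F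
      (\<lambda>i. 2 * cos ((2 * real i - of_bool (odd r)) * pi / real m))"
    unfolding \<theta>_def by (intro exI[of _ F])
qed

section \<open>The toroidal grid\<close>

lemma average_degree_regular:
  assumes "signed_graph S" "\<And>v. v \<in> verts S \<Longrightarrow> vertex_degree S v = k" "verts S \<noteq> {}"
  shows "average_degree S = real k"
proof -
  have "k * card (verts S) = 2 * card (edges S)"
    using sum_vertex_degree[OF assms(1)] assms(2) by (simp add: mult.commute)
  moreover have "card (verts S) > 0" using assms by (simp add: signed_graph_def card_gt_0_iff)
  ultimately show ?thesis
    by (simp add: average_degree_def field_simps flip: of_nat_mult)
qed

text \<open>The angle is 2 pi (2i - [r]) / (2m), so the cosine is 1 iff 2m divides 2i - [r]. This
  excludes odd r; for even r it says that m divides i, which in the range 1..m happens at i = m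
  alone.\<close>

lemma cos_cycle_eq_1_iff:
  assumes "i \<in> {1..m}"
  shows "cos ((2 * real i - of_bool (odd r)) * pi / real m) = 1 \<longleftrightarrow> even r \<and> i = m"
proof -
  define a where "a = 2 * int i - of_bool (odd r)"
  have "(2 * real i - of_bool (odd r)) * pi / real m = 2 * pi * real_of_int a / real (2 * m)"
    using assms by (simp add: a_def field_simps)
  then have "cos ((2 * real i - of_bool (odd r)) * pi / real m) = 1 \<longleftrightarrow> int (2 * m) dvd a"
    using cos_two_pi_int_div_eq_1_iff[of "2 * m" a] assms by (simp only:) simp
  also have "\<dots> \<longleftrightarrow> even r \<and> i = m"
  proof
    assume dvd: "int (2 * m) dvd a"
    then have "even a" by (metis dvd_trans dvd_triv_left of_nat_mult of_nat_numeral)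
    then have r: "even r" by (auto simp: a_def of_bool_def split: if_splits)
    then have "m dvd i" using dvd by (simp add: a_def)
    then show "even r \<and> i = m" using r assms dvd_imp_le[of m i] by auto
  qed (simp add: a_def)
  finally show ?thesis .
qed

theorem corollary4p11:
  fixes m n r\<^sub>1 r\<^sub>2 :: nat
    and C\<^sub>1 :: "'a sgraph" and C\<^sub>2 :: "'b sgraph"
    and H :: "'a \<times> 'b \<Rightarrow> ('a \<times> 'b) set \<Rightarrow> int"
  assumes "signed_cycle m r\<^sub>1 C\<^sub>1" and "signed_cycle n r\<^sub>2 C\<^sub>2"
    and "r\<^sub>1 \<le> m" and "r\<^sub>2 \<le> n"
    and "incidence_matrix (cart_prod C\<^sub>1 C\<^sub>2) H"
  shows
    "let \<Lambda> = line_graph (cart_prod C\<^sub>1 C\<^sub>2) H;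
         c = (\<lambda>i j. cos ((2 * real i - of_bool (odd r\<^sub>1)) * pi / real m) +
                     cos ((2 * real j - of_bool (odd r\<^sub>2)) * pi / real n));
         lam = (\<lambda>i j. 2 * (c i j - 1));
         lamL = (\<lambda>i j. 8 - 2 * c i j);
         E = 2 * real m * real n + 2 * (\<Sum>i=1..m. \<Sum>j=1..n. \<bar>c i j - 1\<bar>)
     in
       eigenvalues \<Lambda> =
         image_mset (\<lambda>(i, j). lam i j) (mset_set ({1..m} \<times> {1..n})) + replicate_mset (m * n) 2 \<and>
       (\<forall>i\<in>{1..m}. \<forall>j\<in>{1..n}.
          \<not> (even r\<^sub>1 \<and> even r\<^sub>2 \<and> i = m \<and> j = n) \<longrightarrow> lam i j < 2) \<and>
       (even r\<^sub>1 \<and> even r\<^sub>2 \<longrightarrow> lam m n = 2) \<and>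
       laplacian_eigenvalues \<Lambda> =
         image_mset (\<lambda>(i, j). lamL i j) (mset_set ({1..m} \<times> {1..n})) + replicate_mset (m * n) 4 \<and>
       (\<forall>i\<in>{1..m}. \<forall>j\<in>{1..n}.
          \<not> (even r\<^sub>1 \<and> even r\<^sub>2 \<and> i = m \<and> j = n) \<longrightarrow> lamL i j > 4) \<and>
       (even r\<^sub>1 \<and> even r\<^sub>2 \<longrightarrow> lamL m n = 4) \<and>
       energy \<Lambda> = E \<and>
       laplacian_energy \<Lambda> = E"
proof -
  let ?S = "cart_prod C\<^sub>1 C\<^sub>2"
  let ?c1 = "\<lambda>i. cos ((2 * real i - of_bool (odd r\<^sub>1)) * pi / real m)"
  let ?c2 = "\<lambda>j. cos ((2 * real j - of_bool (odd r\<^sub>2)) * pi / real n)"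
  define c where "c = (\<lambda>i j. ?c1 i + ?c2 j)"
  define \<Lambda> where "\<Lambda> = line_graph ?S H"
  define I where "I = {1..m} \<times> {1..n}"
  have C: "signed_graph C\<^sub>1" "signed_graph C\<^sub>2" "m \<ge> 3" "n \<ge> 3"
    using assms(1,2) by (auto simp: signed_cycle_def)
  have S: "signed_graph ?S" by (rule signed_graph_cart_prod[OF C(1,2)])
  have V: "verts ?S = verts C\<^sub>1 \<times> verts C\<^sub>2" by (simp add: cart_prod_def)
  note spec1 = signed_cycle_spectrum[OF assms(1)] and spec2 = signed_cycle_spectrum[OF assms(2)]
  obtain F where F: "orthogonal_eigenbasis (verts C\<^sub>1) (adj C\<^sub>1) {1..m} F (\<lambda>i. 2 * ?c1 i)"
    using spec1(1) by blast
  obtain G where G: "orthogonal_eigenbasis (verts C\<^sub>2) (adj C\<^sub>2) {1..n} G (\<lambda>j. 2 * ?c2 j)"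
    using spec2(1) by blast
  have reg: "vertex_degree ?S w = 4" if "w \<in> verts ?S" for w
    using that spec1(3) spec2(3) vertex_degree_cart_prod[OF C(1,2)] by (auto simp: V)
  have card_V: "card (verts ?S) = m * n" using spec1(2) spec2(2) by (simp add: V card_cartesian_product)
  \<comment> \<open>Degree 4 gives 4mn = 2 |E|; the surplus |E| - |V| = mn is the additional
    multiplicity in both spectra.\<close>
  have card_E: "card (edges ?S) = 2 * (m * n)" using sum_vertex_degree[OF S] reg card_V by simp
  have basis: "orthogonal_eigenbasis (verts ?S) (adj ?S) I
      (\<lambda>(i, j) (u, w). F i u * G j w) (\<lambda>(i, j). 2 * c i j)"
    unfolding V I_def
    by (rule orthogonal_eigenbasis_cong[OF orthogonal_eigenbasis_kronecker_sum[OF F G]])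
      (use C in \<open>auto simp: signed_graph_def c_def adj_cart_prod[OF C(1,2)]\<close>)
  note spec = line_graph_spectrum_of_regular[OF S assms(5) reg _ basis, folded \<Lambda>_def]
  have eigenvalues: "eigenvalues \<Lambda> =
      image_mset (\<lambda>(i, j). 2 * (c i j - 1)) (mset_set I) + replicate_mset (m * n) 2"
    using spec(1) by (simp add: card_V card_E case_prod_unfold algebra_simps)
  have laplacian_eigenvalues: "laplacian_eigenvalues \<Lambda> =
      image_mset (\<lambda>(i, j). 8 - 2 * c i j) (mset_set I) + replicate_mset (m * n) 4"
    using spec(2) by (simp add: card_V card_E case_prod_unfold)
  \<comment> \<open>Both 2 (c - 1) < 2 and 8 - 2c > 4 amount to c < 2, so a single analysis of the
    equality case settles the two strict bounds.\<close>
  have c: "c i j \<le> 2" "c i j = 2 \<longleftrightarrow> even r\<^sub>1 \<and> even r\<^sub>2 \<and> i = m \<and> j = n"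
    if "i \<in> {1..m}" "j \<in> {1..n}" for i j
  proof -
    have "?c1 i \<le> 1" "?c2 j \<le> 1" by (rule cos_le_one)+
    then show "c i j \<le> 2" unfolding c_def by linarith
    have "c i j = 2 \<longleftrightarrow> ?c1 i = 1 \<and> ?c2 j = 1"
      using \<open>?c1 i \<le> 1\<close> \<open>?c2 j \<le> 1\<close> unfolding c_def by linarith
    then show "c i j = 2 \<longleftrightarrow> even r\<^sub>1 \<and> even r\<^sub>2 \<and> i = m \<and> j = n"
      unfolding cos_cycle_eq_1_iff[OF that(1)] cos_cycle_eq_1_iff[OF that(2)] by blast
  qed
  have strict: "c i j < 2"
    if "i \<in> {1..m}" "j \<in> {1..n}" "\<not> (even r\<^sub>1 \<and> even r\<^sub>2 \<and> i = m \<and> j = n)" for i j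
    using c[OF that(1,2)] that(3) by (meson order_le_less)
  have top: "c m n = 2" if "even r\<^sub>1" "even r\<^sub>2" using c(2)[of m n] that C by simp
  define E where "E = 2 * real m * real n + 2 * (\<Sum>i=1..m. \<Sum>j=1..n. \<bar>c i j - 1\<bar>)"
  have sum_I: "(\<Sum>(i, j)\<in>I. 2 * \<bar>c i j - 1\<bar>) = 2 * (\<Sum>i=1..m. \<Sum>j=1..n. \<bar>c i j - 1\<bar>)"
    by (simp add: I_def sum.cartesian_product sum_distrib_left split_beta)
  \<comment> \<open>The first identity is for the eigenvalues, the second for the deviations of the
    Laplacian eigenvalues from the average degree 6. The remaining mn eigenvalues contribute |2| and
    |4 - 6|, that is 2mn to each energy.\<close>
  have abs2: "\<bar>2 * c i j - 2\<bar> = 2 * \<bar>c i j - 1\<bar>" "\<bar>2 - 2 * c i j\<bar> = 2 * \<bar>c i j - 1\<bar>" for i j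
    by (auto simp: abs_if)
  have energy: "energy \<Lambda> = E"
    unfolding energy_def eigenvalues E_def sum_I[symmetric]
    by (simp add: sum_unfold_sum_mset split_beta abs2 image_mset.compositionality o_def del: abs_mult)
  have "vertex_degree \<Lambda> e = 6" if "e \<in> verts \<Lambda>" for e
  proof -
    have e: "e \<in> edges ?S" using that by (simp add: \<Lambda>_def line_graph_def)
    then have "card e = 2" using S by (simp add: signed_graph_def)
    then obtain u v where uv: "e = {u, v}" by (auto simp: card_2_iff)
    then show ?thesis
      using vertex_degree_line_graph[OF S assms(5), of u v] signed_graph_edgeD[OF S, of u v] e reg
      by (simp add: \<Lambda>_def)
  qed
  moreover have "verts \<Lambda> \<noteq> {}" using card_E C by (auto simp: \<Lambda>_def line_graph_def)
  ultimately have avg: "average_degree \<Lambda> = 6"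
    using average_degree_regular[of \<Lambda> 6] signed_graph_line_graph[OF S assms(5)] by (simp add: \<Lambda>_def)
  have laplacian_energy: "laplacian_energy \<Lambda> = E"
    unfolding laplacian_energy_def laplacian_eigenvalues avg E_def sum_I[symmetric]
    by (simp add: sum_unfold_sum_mset split_beta abs2 image_mset.compositionality o_def del: abs_mult)
  show ?thesis
    unfolding \<Lambda>_def[symmetric] c_def[symmetric] I_def[symmetric]
    unfolding Let_def E_def[symmetric]
  proof (intro conjI ballI impI)
    fix i j
    assume "i \<in> {1..m}" "j \<in> {1..n}" "\<not> (even r\<^sub>1 \<and> even r\<^sub>2 \<and> i = m \<and> j = n)"
    then have "c i j < 2" by (rule strict)
    then show "2 * (c i j - 1) < 2" "8 - 2 * c i j > 4" by simp_all
  next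
    assume "even r\<^sub>1 \<and> even r\<^sub>2"
    then have "c m n = 2" using top by blast
    then show "2 * (c m n - 1) = 2" "8 - 2 * c m n = 4" by simp_all
  qed (rule eigenvalues laplacian_eigenvalues energy laplacian_energy)+
qed

end
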